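(* Let $H$ be a real Hilbert space and let $A$ be a self-adjoint linear operator on $H$ with dense domain $D(A)$ such that $$\inf\{\langle Au,u\rangle: u\in D(A),\ |u|=1\}>0 .$$ Let $p\in[0,1]$, $(u_0,u_1)\in D(A)\times D(A^{1/2})$, and $\varepsilon>0$. Let $c_\varepsilon:[0,+\infty)\to(0,+\infty)$ be a function of class $C^1$ for which there are constants $\mu>0$, $M_3$, $M_4$ such that $$\mu\le c_\varepsilon(t)\le M_3,\qquad |c_\varepsilon'(t)|\le\frac{M_4}{(1+t)^p}\qquad\forall t\ge 0.$$ Let $u_\varepsilon\in C^2([0,+\infty);H)\cap C^1([0,+\infty);D(A^{1/2}))\cap C^0([0,+\infty);D(A))$ be the solution of $$\varepsilon u_\varepsilon''(t)+\frac{1}{(1+t)^p}u_\varepsilon'(t)+c_\varepsilon(t)Au_\varepsilon(t)=0\quad\forall t\ge 0,\qquad u_\varepsilon(0)=u_0,\quad u_\varepsilon'(0)=u_1.$$ If $(u_0,u_1)\ne(0,0)$, then $$\lim_{t\to+\infty}\left(\varepsilon|u_\varepsilon'(t)|^2+|A^{1/2}u_\varepsilon(t)|^2\right)\frac{1}{\Phi(t)}=+\infty$$ for every function $\Phi:[0,+\infty)\to(0,+\infty)$ of class $C^1$ such that $$\lim_{t\to+\infty}(1+t)^p\,\frac{\Phi'(t)}{\Phi(t)}=-\infty .$$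
   Context: $|x|$ and $\langle x,y\rangle$ denote the norm and scalar product of $H$. The operator $A$ may be unbounded; its powers $A^\alpha$ ($\alpha\ge 0$) are defined by the spectral theorem on domains $D(A^\alpha)$, endowed with the graph norm. *)

theory Defs
  imports "HOL-Analysis.Analysis"
begin

text \<open>
  A (possibly unbounded) operator on \<open>H\<close> is represented by its graph; its domain is
  then \<^const>\<open>Domain\<close> of the graph.
\<close>

type_synonym 'a graph_op = "('a \<times> 'a) set"

definition linear_op :: "'a::real_vector graph_op \<Rightarrow> bool" where
  "linear_op A \<longleftrightarrow> subspace A \<and> single_valued A"

definition op_app :: "'a graph_op \<Rightarrow> 'a \<Rightarrow> 'a" where
  "op_app A u = (THE w. (u, w) \<in> A)"

definition adjoint_op :: "'a::real_inner graph_op \<Rightarrow> 'a graph_op" where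
  "adjoint_op A = {(v, w). \<forall>(x, y)\<in>A. inner y v = inner x w}"

definition self_adjoint :: "'a::real_inner graph_op \<Rightarrow> bool" where
  "self_adjoint A \<longleftrightarrow> linear_op A \<and> closure (Domain A) = UNIV \<and> adjoint_op A = A"

text \<open>Projection-valued measures on the Borel sets of the real line.\<close>

definition projection_valued_measure :: "(real set \<Rightarrow> 'a::real_inner \<Rightarrow> 'a) \<Rightarrow> bool" where
  "projection_valued_measure E \<longleftrightarrow>
     (\<forall>B\<in>sets borel. linear (E B) \<and> E B \<circ> E B = E B \<and>
        (\<forall>u v. inner (E B u) v = inner u (E B v))) \<and>
     E UNIV = id \<and>
     (\<forall>B\<in>sets borel. \<forall>C\<in>sets borel. E (B \<inter> C) = E B \<circ> E C) \<and>
     (\<forall>F u. range F \<subseteq> sets borel \<longrightarrow> disjoint_family F \<longrightarrow>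
        (\<lambda>n::nat. E (F n) u) sums E (\<Union>n. F n) u)"

definition scalar_measure ::
    "(real set \<Rightarrow> 'a::real_inner \<Rightarrow> 'a) \<Rightarrow> 'a \<Rightarrow> real measure" where
  "scalar_measure E u = measure_of UNIV (sets borel) (\<lambda>B. ennreal (inner (E B u) u))"

definition spectral_domain ::
    "(real set \<Rightarrow> 'a::real_inner \<Rightarrow> 'a) \<Rightarrow> (real \<Rightarrow> real) \<Rightarrow> 'a set" where
  "spectral_domain E f = {u. (\<integral>\<^sup>+ x. ennreal ((f x)\<^sup>2) \<partial>scalar_measure E u) < \<infinity>}"

text \<open>
  The operator \<open>\<integral> f dE\<close> for a real Borel function \<open>f\<close>. The equation
  \<open>\<langle>w, v\<rangle> = \<integral> f d\<langle>E u, v\<rangle>\<close> is written with the polarization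
  \<open>4 \<langle>E u, v\<rangle> = \<langle>E (u + v), u + v\<rangle> - \<langle>E (u - v), u - v\<rangle>\<close>. It is tested on \<open>v\<close>
  in the (dense) spectral domain only, as both integrals converge there; this
  determines \<open>w\<close>.
\<close>

definition spectral_integral ::
    "(real set \<Rightarrow> 'a::real_inner \<Rightarrow> 'a) \<Rightarrow> (real \<Rightarrow> real) \<Rightarrow> 'a graph_op" where
  "spectral_integral E f =
     {(u, w). u \<in> spectral_domain E f \<and>
        (\<forall>v\<in>spectral_domain E f.
           inner w v = ((\<integral>x. f x \<partial>scalar_measure E (u + v)) -
                        (\<integral>x. f x \<partial>scalar_measure E (u - v))) / 4)}"

definition spectral_resolution ::
    "'a::real_inner graph_op \<Rightarrow> (real set \<Rightarrow> 'a \<Rightarrow> 'a) \<Rightarrow> bool" where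
  "spectral_resolution A E \<longleftrightarrow>
     projection_valued_measure E \<and> A = spectral_integral E (\<lambda>x. x)"

text \<open>
  \<open>A\<^sup>\<alpha> = \<integral> x\<^sup>\<alpha> dE\<close>, where \<open>E\<close> is the spectral resolution of \<open>A\<close>. By the spectral
  theorem \<open>E\<close> exists for every self-adjoint \<open>A\<close> on a Hilbert space and is unique on Borel
  sets; the empty graph is only the totalization for operators without a spectral
  resolution. The definition is meant for positive \<open>A\<close> with trivial kernel, where \<open>E\<close>
  vanishes on \<open>{..0}\<close> and the values of \<^const>\<open>powr\<close> there are irrelevant.
\<close>

definition op_powr :: "'a::real_inner graph_op \<Rightarrow> real \<Rightarrow> 'a graph_op" where
  "op_powr A \<alpha> =
     (if \<exists>E. spectral_resolution A E
      then spectral_integral (SOME E. spectral_resolution A E) (\<lambda>x. x powr \<alpha>)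
      else {})"

text \<open>
  The classes \<open>C\<^sup>0([0,\<infinity>); D(A))\<close> and \<open>C\<^sup>1([0,\<infinity>); D(A))\<close>, with \<open>D(A)\<close> under the graph norm;
  in the second, \<open>u'\<close> is the derivative of \<open>u\<close>.
\<close>

definition graph_norm :: "'a::real_inner graph_op \<Rightarrow> 'a \<Rightarrow> real" where
  "graph_norm A x = sqrt ((norm x)\<^sup>2 + (norm (op_app A x))\<^sup>2)"

definition C0_domain :: "'a::real_inner graph_op \<Rightarrow> (real \<Rightarrow> 'a) \<Rightarrow> bool" where
  "C0_domain A u \<longleftrightarrow>
     (\<forall>t\<ge>0. u t \<in> Domain A) \<and>
     (\<forall>t\<ge>0. ((\<lambda>s. graph_norm A (u s - u t)) \<longlongrightarrow> 0) (at t within {0..}))"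

definition C1_domain :: "'a::real_inner graph_op \<Rightarrow> (real \<Rightarrow> 'a) \<Rightarrow> (real \<Rightarrow> 'a) \<Rightarrow> bool" where
  "C1_domain A u u' \<longleftrightarrow>
     (\<forall>t\<ge>0. u t \<in> Domain A) \<and>
     C0_domain A u' \<and>
     (\<forall>t\<ge>0. ((\<lambda>s. graph_norm A ((u s - u t) /\<^sub>R (s - t) - u' t)) \<longlongrightarrow> 0) (at t within {0..}))"

end

theory Submission
  imports Defs
begin

text \<open>
  The weighted energy \<open>e = \<epsilon> |u'|\<^sup>2 + c |A\<^bsup>1/2\<^esup> u|\<^sup>2\<close> cannot decay too fast: by the equation
  \<open>e' = c' |A\<^bsup>1/2\<^esup> u|\<^sup>2 - 2 (1 + t)\<^bsup>-p\<^esup> |u'|\<^sup>2 \<ge> - k (1 + t)\<^bsup>-p\<^esup> e\<close> with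
  \<open>k = 2 / \<epsilon> + M4 / \<mu>\<close>. In particular \<open>e\<close> stays positive when the data are not both zero. The
  hypothesis on \<open>\<Phi>\<close> makes \<open>\<Phi>\<close> eventually decay faster than at any prescribed multiple of the rate
  \<open>(1 + t)\<^bsup>-p\<^esup>\<close>, so eventually \<open>(log (e / \<Phi>))' \<ge> (1 + t)\<^bsup>-p\<^esup>\<close>. For \<open>p \<le> 1\<close> this rate has infinite integral, and
  \<open>e / \<Phi>\<close> tends to infinity (\<open>ratio_at_top\<close>); as \<open>c\<close> is bounded, so does the energy without
  the weight.

  The functional analysis enters through two facts. First, \<open>|A\<^bsup>1/2\<^esup> x|\<^sup>2 = \<langle>A x, x\<rangle>\<close> on the
  domain of \<open>A\<close> (\<open>op_powr_half_norm\<close>). It comes from the spectral resolution \<open>E\<close>: the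
  isometry \<open>|(\<integral> f dE) x|\<^sup>2 = \<integral> f\<^sup>2 d\<langle>E x, x\<rangle>\<close> (\<open>spectral_integral_norm\<close>), combined with the
  fact that coercivity confines the scalar measure of \<open>x\<close> to the positive half-line
  (\<open>spectral_measure_nonpos_null\<close>). Second, \<open>t \<mapsto> \<langle>A u(t), u(t)\<rangle>\<close> has the derivative
  \<open>2 \<langle>A u, u'\<rangle>\<close> although \<open>A u\<close> is merely continuous, by the symmetry of \<open>A\<close>
  (\<open>quadratic_form_derivative\<close>). After these, \<open>A\<^bsup>1/2\<^esup>\<close> no longer occurs in the energy
  estimate.
\<close>

section \<open>Integrals against measures linked by a linear identity\<close>

text \<open>
  Integrals against the signed measure \<open>\<langle>E u, v\<rangle>\<close> only occur as differences of integrals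
  against two positive measures. An identity between such signed measures, rearranged so that
  no subtraction is left, relates four positive measures; it passes to nonnegative functions
  by monotone approximation and then to integrable functions by splitting into
  positive and negative parts.
\<close>

lemma nn_integral_four_measures:
  fixes M1 M2 M3 M4 :: "'b measure"
  assumes S: "sets M1 = sets N" "sets M2 = sets N" "sets M3 = sets N" "sets M4 = sets N"
    and eq: "\<And>B. B \<in> sets N \<Longrightarrow>
      emeasure M1 B + emeasure M2 B = emeasure M3 B + emeasure M4 B"
    and f: "f \<in> borel_measurable N"
  shows "(\<integral>\<^sup>+x. f x \<partial>M1) + (\<integral>\<^sup>+x. f x \<partial>M2) = (\<integral>\<^sup>+x. f x \<partial>M3) + (\<integral>\<^sup>+x. f x \<partial>M4)"
proof -
  note [measurable_cong] = S
  have sp: "space M1 = space N" "space M2 = space N" "space M3 = space N" "space M4 = space N"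
    using S by (auto dest: sets_eq_imp_space_eq)
  show ?thesis
    using f
  proof (induction rule: borel_measurable_induct)
    case (cong f g)
    have "(\<integral>\<^sup>+x. f x \<partial>M) = (\<integral>\<^sup>+x. g x \<partial>M)" if "space M = space N" for M :: "'b measure"
      using cong that by (intro nn_integral_cong) auto
    then show ?case
      using cong sp by simp
  next
    case (set B)
    then show ?case
      using eq[of B] S by simp
  next
    case (mult g c)
    then show ?case
      by (simp add: nn_integral_cmult flip: distrib_left)
  next
    case (add g h)
    then show ?case
      by (simp add: nn_integral_add) (metis (no_types, lifting) add.assoc add.left_commute)
  next
    case (seq F)
    have [measurable]: "\<And>i. F i \<in> borel_measurable N"
      using seq by auto
    have inc: "incseq (\<lambda>i. \<integral>\<^sup>+x. F i x \<partial>M)" for M :: "'b measure"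
      using \<open>incseq F\<close> by (auto simp: incseq_def le_fun_def intro!: nn_integral_mono)
    have sup: "(\<integral>\<^sup>+x. (SUP i. F i) x \<partial>M) = (SUP i. \<integral>\<^sup>+x. F i x \<partial>M)"
      if "sets M = sets N" for M :: "'b measure"
    proof -
      note [measurable_cong] = that
      show ?thesis
        using nn_integral_monotone_convergence_SUP[OF \<open>incseq F\<close>, of M]
        by (simp add: image_comp)
    qed
    show ?case
      using seq(3-) by (simp only: sup[OF S(1)] sup[OF S(2)] sup[OF S(3)] sup[OF S(4)]
          ennreal_SUP_add[OF inc inc, symmetric])
  qed
qed

lemma integral_four_measures:
  fixes M1 M2 M3 M4 :: "'b measure" and f :: "'b \<Rightarrow> real"
  assumes S: "sets M1 = sets N" "sets M2 = sets N" "sets M3 = sets N" "sets M4 = sets N"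
    and eq: "\<And>B. B \<in> sets N \<Longrightarrow>
      emeasure M1 B + emeasure M2 B = emeasure M3 B + emeasure M4 B"
    and int: "integrable M1 f" "integrable M2 f" "integrable M3 f" "integrable M4 f"
  shows "(\<integral>x. f x \<partial>M1) + (\<integral>x. f x \<partial>M2) = (\<integral>x. f x \<partial>M3) + (\<integral>x. f x \<partial>M4)"
proof -
  have f: "f \<in> borel_measurable N"
    using int(1) S(1) measurable_cong_sets by blast
  have id: "enn2real (\<integral>\<^sup>+x. ennreal (g x) \<partial>M1) + enn2real (\<integral>\<^sup>+x. ennreal (g x) \<partial>M2)
      = enn2real (\<integral>\<^sup>+x. ennreal (g x) \<partial>M3) + enn2real (\<integral>\<^sup>+x. ennreal (g x) \<partial>M4)"
    if g: "g \<in> borel_measurable N" "integrable M1 g" "integrable M2 g"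
      "integrable M3 g" "integrable M4 g"
    for g :: "'b \<Rightarrow> real"
  proof -
    have fin: "(\<integral>\<^sup>+x. ennreal (g x) \<partial>M) < top" if "integrable M g" for M
    proof -
      have "(\<integral>\<^sup>+x. ennreal (g x) \<partial>M) \<le> (\<integral>\<^sup>+x. ennreal (norm (g x)) \<partial>M)"
        by (intro nn_integral_mono ennreal_leI) auto
      also have "\<dots> < top"
        using that by (simp add: integrable_iff_bounded)
      finally show ?thesis .
    qed
    have "(\<integral>\<^sup>+x. ennreal (g x) \<partial>M1) + (\<integral>\<^sup>+x. ennreal (g x) \<partial>M2)
      = (\<integral>\<^sup>+x. ennreal (g x) \<partial>M3) + (\<integral>\<^sup>+x. ennreal (g x) \<partial>M4)"
      by (rule nn_integral_four_measures[OF S eq]) (use g in simp_all)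
    then show ?thesis
      using fin g by (metis enn2real_plus)
  qed
  have "integral\<^sup>L M f = enn2real (\<integral>\<^sup>+x. ennreal (f x) \<partial>M) - enn2real (\<integral>\<^sup>+x. ennreal (- f x) \<partial>M)"
    if "integrable M f" for M :: "'b measure"
    using that by (rule real_lebesgue_integral_def)
  then show ?thesis
    using id[of f] id[of "\<lambda>x. - f x"] f int by simp
qed

section \<open>The scalar measures of a projection-valued measure\<close>

context
  fixes E :: "real set \<Rightarrow> 'a::real_inner \<Rightarrow> 'a"
  assumes pvm: "projection_valued_measure E"
begin

lemma pvm_linear: "B \<in> sets borel \<Longrightarrow> linear (E B)"
  and pvm_sym: "B \<in> sets borel \<Longrightarrow> inner (E B x) y = inner x (E B y)"
  and pvm_UNIV: "E UNIV x = x"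
  and pvm_Int: "B \<in> sets borel \<Longrightarrow> C \<in> sets borel \<Longrightarrow> E B (E C x) = E (B \<inter> C) x"
  and pvm_sums: "range F \<subseteq> sets borel \<Longrightarrow> disjoint_family F \<Longrightarrow>
     (\<lambda>n::nat. E (F n) x) sums E (\<Union>n. F n) x"
  using pvm unfolding projection_valued_measure_def by auto

lemmas pvm_add = linear_add[OF pvm_linear]
lemmas pvm_diff = linear_diff[OF pvm_linear]
lemmas pvm_scale = linear_scale[OF pvm_linear]

lemma pvm_inner_Int:
  assumes "B \<in> sets borel" "C \<in> sets borel"
  shows "inner (E B x) (E C y) = inner (E (B \<inter> C) x) y"
  using assms by (metis pvm_Int pvm_sym inf_commute)

lemma pvm_inner_self: "B \<in> sets borel \<Longrightarrow> inner (E B x) x = (norm (E B x))\<^sup>2"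
  using pvm_inner_Int[of B B x x] by (simp add: power2_norm_eq_inner)

lemma pvm_form_nonneg: "B \<in> sets borel \<Longrightarrow> 0 \<le> inner (E B x) x"
  by (simp add: pvm_inner_self)

lemma pvm_polarization:
  assumes "B \<in> sets borel"
  shows "inner (E B (x + y)) (x + y) - inner (E B (x - y)) (x - y) = 4 * inner (E B x) y"
proof -
  have "inner (E B y) x = inner (E B x) y"
    using assms by (metis inner_commute pvm_sym)
  then show ?thesis
    using assms by (simp add: pvm_add pvm_diff inner_simps)
qed

lemma pvm_empty: "E {} x = 0"
proof -
  have "(\<lambda>n::nat. E {} x) sums E {} x"
    using pvm_sums[of "\<lambda>_. {}" x] by (simp add: disjoint_family_on_def)
  then have "(\<lambda>n::nat. E {} x) \<longlonglongrightarrow> 0"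
    by (intro summable_LIMSEQ_zero sums_summable)
  then show ?thesis
    by (simp add: LIMSEQ_const_iff)
qed

lemma sets_scalar_measure [simp, measurable_cong]: "sets (scalar_measure E x) = sets borel"
  unfolding scalar_measure_def
  using sets.sets_measure_of_eq[of "borel :: real measure"] by simp

lemma space_scalar_measure [simp]: "space (scalar_measure E x) = UNIV"
  using sets_eq_imp_space_eq[OF sets_scalar_measure] by simp

lemma emeasure_scalar_measure:
  assumes B: "B \<in> sets borel"
  shows "emeasure (scalar_measure E x) B = ennreal (inner (E B x) x)"
proof (rule emeasure_measure_of[OF scalar_measure_def])
  show "positive (sets (scalar_measure E x)) (\<lambda>B. ennreal (inner (E B x) x))"
    by (simp add: positive_def pvm_empty)
  show "countably_additive (sets (scalar_measure E x)) (\<lambda>B. ennreal (inner (E B x) x))"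
  proof (rule countably_additiveI)
    fix F :: "nat \<Rightarrow> real set"
    assume F: "range F \<subseteq> sets (scalar_measure E x)" "disjoint_family F"
    then have s: "(\<lambda>n. inner (E (F n) x) x) sums inner (E (\<Union>n. F n) x) x"
      using bounded_linear.sums[OF bounded_linear_inner_left, OF pvm_sums[of F x]] by simp
    have "(\<Sum>n. ennreal (inner (E (F n) x) x)) = ennreal (\<Sum>n. inner (E (F n) x) x)"
      using F s by (intro suminf_ennreal2 pvm_form_nonneg) (auto simp: sums_iff)
    then show "(\<Sum>n. ennreal (inner (E (F n) x) x)) = ennreal (inner (E (\<Union>n. F n) x) x)"
      using s by (simp add: sums_iff)
  qed
qed (use B in auto)

lemma emeasure_scalar_measure_add:
  assumes "B \<in> sets borel"
  shows "emeasure (scalar_measure E x) B + emeasure (scalar_measure E y) B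
    = ennreal (inner (E B x) x + inner (E B y) y)"
  using assms by (simp add: emeasure_scalar_measure pvm_form_nonneg)

lemma finite_scalar_measure: "finite_measure (scalar_measure E x)"
  by (rule finite_measureI) (simp add: emeasure_scalar_measure)

lemma scalar_measure_scale:
  "scalar_measure E (r *\<^sub>R x) = density (scalar_measure E x) (\<lambda>_. ennreal (r\<^sup>2))"
  by (rule measure_eqI)
    (auto simp: emeasure_scalar_measure emeasure_density nn_integral_cmult_indicator pvm_scale
      pvm_form_nonneg power2_eq_square mult.assoc simp flip: ennreal_mult')

lemma scalar_measure_project:
  assumes "C \<in> sets borel"
  shows "scalar_measure E (E C x) = density (scalar_measure E x) (indicator C)"
  using assms
  by (intro measure_eqI)
    (auto simp: emeasure_scalar_measure emeasure_density pvm_inner_Int pvm_Int Int_ac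
      simp flip: indicator_inter_arith)

lemma integral_scalar_measure_scale:
  fixes f :: "real \<Rightarrow> real"
  assumes "f \<in> borel_measurable borel"
  shows "(\<integral>t. f t \<partial>scalar_measure E (r *\<^sub>R x)) = r\<^sup>2 * (\<integral>t. f t \<partial>scalar_measure E x)"
  using assms by (subst scalar_measure_scale, subst integral_density) auto

lemma integral_scalar_measure_zero:
  fixes f :: "real \<Rightarrow> real"
  assumes "f \<in> borel_measurable borel"
  shows "(\<integral>t. f t \<partial>scalar_measure E 0) = 0"
  using integral_scalar_measure_scale[OF assms, of 0 0] by simp

lemma integral_scalar_measure_project:
  fixes f :: "real \<Rightarrow> real"
  assumes "C \<in> sets borel" "f \<in> borel_measurable borel"
  shows "(\<integral>t. f t \<partial>scalar_measure E (E C x)) = (\<integral>t. indicator C t * f t \<partial>scalar_measure E x)"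
proof -
  have "scalar_measure E (E C x) = density (scalar_measure E x) (\<lambda>t. ennreal (indicator C t))"
    using scalar_measure_project[OF assms(1)] by (simp add: ennreal_indicator)
  then show ?thesis
    using assms by (simp add: integral_density)
qed

section \<open>Spectral domains\<close>

lemma spectral_domain_iff:
  "x \<in> spectral_domain E f \<longleftrightarrow> (\<integral>\<^sup>+t. ennreal ((f t)\<^sup>2) \<partial>scalar_measure E x) < top"
  by (simp add: spectral_domain_def)

lemma spectral_domain_scale:
  assumes "f \<in> borel_measurable borel" "x \<in> spectral_domain E f"
  shows "r *\<^sub>R x \<in> spectral_domain E f"
  using assms
  by (simp add: spectral_domain_iff scalar_measure_scale nn_integral_density nn_integral_cmult
      ennreal_mult_less_top)

text \<open>
  The parallelogram law for the seminorm \<open>|E B \<cdot>|\<close> bounds the measures of \<open>x + y\<close> and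
  \<open>x - y\<close>; the factor \<open>2\<close> in that law is absorbed into the vectors as \<open>\<surd>2\<close>.
\<close>

lemma spectral_domain_add_diff:
  assumes f [measurable]: "f \<in> borel_measurable borel"
    and xy: "x \<in> spectral_domain E f" "y \<in> spectral_domain E f"
  shows "x + y \<in> spectral_domain E f" "x - y \<in> spectral_domain E f"
proof -
  let ?m = "scalar_measure E" and ?r = "sqrt 2"
  have "emeasure (?m (x + y)) B + emeasure (?m (x - y)) B
      = emeasure (?m (?r *\<^sub>R x)) B + emeasure (?m (?r *\<^sub>R y)) B" if "B \<in> sets borel" for B
  proof -
    have "inner (E B (x + y)) (x + y) + inner (E B (x - y)) (x - y)
      = inner (E B (?r *\<^sub>R x)) (?r *\<^sub>R x) + inner (E B (?r *\<^sub>R y)) (?r *\<^sub>R y)"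
      using that by (simp add: pvm_add pvm_diff pvm_scale inner_simps flip: mult.assoc)
    then show ?thesis
      unfolding emeasure_scalar_measure_add[OF that] by (rule arg_cong)
  qed
  then have "(\<integral>\<^sup>+t. ennreal ((f t)\<^sup>2) \<partial>?m (x + y)) + (\<integral>\<^sup>+t. ennreal ((f t)\<^sup>2) \<partial>?m (x - y))
      = (\<integral>\<^sup>+t. ennreal ((f t)\<^sup>2) \<partial>?m (?r *\<^sub>R x)) + (\<integral>\<^sup>+t. ennreal ((f t)\<^sup>2) \<partial>?m (?r *\<^sub>R y))"
    by (intro nn_integral_four_measures[where N = borel]) auto
  also have "\<dots> < top"
    using spectral_domain_scale[OF f xy(1)] spectral_domain_scale[OF f xy(2)]
    by (simp add: spectral_domain_iff)
  finally show "x + y \<in> spectral_domain E f" "x - y \<in> spectral_domain E f"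
    by (simp_all add: spectral_domain_iff)
qed

lemma spectral_domain_project:
  assumes f: "f \<in> borel_measurable borel" and C: "C \<in> sets borel"
    and x: "x \<in> spectral_domain E f"
  shows "E C x \<in> spectral_domain E f"
proof -
  have "(\<integral>\<^sup>+t. ennreal ((f t)\<^sup>2) \<partial>scalar_measure E (E C x))
      = (\<integral>\<^sup>+t. indicator C t * ennreal ((f t)\<^sup>2) \<partial>scalar_measure E x)"
    using f C by (simp add: scalar_measure_project nn_integral_density)
  also have "\<dots> \<le> (\<integral>\<^sup>+t. ennreal ((f t)\<^sup>2) \<partial>scalar_measure E x)"
    by (intro nn_integral_mono) (auto simp: indicator_def)
  also have "\<dots> < top"
    using x by (simp add: spectral_domain_iff)
  finally show ?thesis
    by (simp add: spectral_domain_iff)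
qed

lemma spectral_domain_project_bounded:
  assumes f: "f \<in> borel_measurable borel" and C: "C \<in> sets borel"
    and bound: "\<And>t. t \<in> C \<Longrightarrow> \<bar>f t\<bar> \<le> b"
  shows "E C x \<in> spectral_domain E f"
proof -
  have "(\<integral>\<^sup>+t. ennreal ((f t)\<^sup>2) \<partial>scalar_measure E (E C x))
      = (\<integral>\<^sup>+t. indicator C t * ennreal ((f t)\<^sup>2) \<partial>scalar_measure E x)"
    using f C by (simp add: scalar_measure_project nn_integral_density)
  also have "\<dots> \<le> (\<integral>\<^sup>+t. ennreal (b\<^sup>2) \<partial>scalar_measure E x)"
  proof (rule nn_integral_mono)
    fix t
    have "(f t)\<^sup>2 \<le> b\<^sup>2" if "t \<in> C"
      using power_mono[OF bound[OF that], of 2] by simp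
    then show "indicator C t * ennreal ((f t)\<^sup>2) \<le> ennreal (b\<^sup>2)"
      by (cases "t \<in> C") (simp_all add: ennreal_leI)
  qed
  also have "\<dots> < top"
    by (simp add: emeasure_scalar_measure ennreal_mult_less_top)
  finally show ?thesis
    by (simp add: spectral_domain_iff)
qed

lemma spectral_domain_integrable:
  fixes f :: "real \<Rightarrow> real"
  assumes f: "f \<in> borel_measurable borel" and x: "x \<in> spectral_domain E f"
  shows "integrable (scalar_measure E x) f" "integrable (scalar_measure E x) (\<lambda>t. (f t)\<^sup>2)"
proof -
  interpret finite_measure "scalar_measure E x"
    by (rule finite_scalar_measure)
  show f2: "integrable (scalar_measure E x) (\<lambda>t. (f t)\<^sup>2)"
  proof (rule integrableI_nonneg)
    show "(\<lambda>t. (f t)\<^sup>2) \<in> borel_measurable (scalar_measure E x)"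
      using f by measurable
    show "(\<integral>\<^sup>+t. ennreal ((f t)\<^sup>2) \<partial>scalar_measure E x) < \<infinity>"
      using x by (simp add: spectral_domain_iff)
  qed simp
  show "integrable (scalar_measure E x) f"
    by (rule square_integrable_imp_integrable[OF _ f2]) (use f in measurable)
qed

section \<open>Elements of a spectral integral\<close>

lemma level_set_exhaustion:
  fixes f :: "real \<Rightarrow> real"
  assumes "f \<in> borel_measurable borel"
  shows "range (\<lambda>n. {t. \<bar>f t\<bar> \<le> real n}) \<subseteq> sets borel" "incseq (\<lambda>n. {t. \<bar>f t\<bar> \<le> real n})"
    "(\<Union>n. {t. \<bar>f t\<bar> \<le> real n}) = UNIV"
  using assms by (auto simp: incseq_def real_arch_simple)

text \<open>
  The projections \<open>E {t. |f t| \<le> n}\<close> map into the domain of \<open>\<integral> f dE\<close> and converge strongly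
  to the identity, so this domain is dense and the value of \<open>\<integral> f dE\<close> is determined.
\<close>

lemma spectral_integral_single_valued:
  assumes f: "f \<in> borel_measurable borel"
    and w: "(u, w) \<in> spectral_integral E f" "(u, w') \<in> spectral_integral E f"
  shows "w = w'"
proof -
  define z where "z = w - w'"
  have "emeasure (scalar_measure E z) {t. \<bar>f t\<bar> \<le> real n} = 0" for n
  proof -
    let ?C = "{t. \<bar>f t\<bar> \<le> real n}"
    have C: "?C \<in> sets borel"
      using f by measurable
    have "E ?C z \<in> spectral_domain E f"
      by (rule spectral_domain_project_bounded[OF f C]) auto
    moreover have "inner w v = inner w' v" if "v \<in> spectral_domain E f" for v
      using w that unfolding spectral_integral_def by fastforce
    ultimately have "inner z (E ?C z) = 0"
      by (simp add: z_def inner_diff_left)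
    then show ?thesis
      using C by (simp add: emeasure_scalar_measure inner_commute)
  qed
  moreover have "(\<lambda>n. emeasure (scalar_measure E z) {t. \<bar>f t\<bar> \<le> real n})
      \<longlonglongrightarrow> emeasure (scalar_measure E z) (\<Union>n. {t. \<bar>f t\<bar> \<le> real n})"
    using level_set_exhaustion[OF f] by (intro Lim_emeasure_incseq) auto
  ultimately have "emeasure (scalar_measure E z) UNIV = 0"
    using level_set_exhaustion(3)[OF f] by (simp add: LIMSEQ_const_iff)
  then show ?thesis
    by (simp add: emeasure_scalar_measure pvm_UNIV z_def)
qed

text \<open>
  Testing \<open>w = (\<integral> f dE) u\<close> with \<open>E B u\<close> shows that \<open>B \<mapsto> \<langle>E B u, w\<rangle>\<close> has density \<open>f\<close> with
  respect to the scalar measure of \<open>u\<close>.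
\<close>

lemma spectral_integral_inner_project:
  assumes f: "f \<in> borel_measurable borel" and uw: "(u, w) \<in> spectral_integral E f"
    and B: "B \<in> sets borel"
  shows "inner w (E B u) = (\<integral>t. indicator B t * f t \<partial>scalar_measure E u)"
proof -
  let ?m = "scalar_measure E"
  have u: "u \<in> spectral_domain E f"
    using uw by (simp add: spectral_integral_def)
  have v: "E B u \<in> spectral_domain E f" "(2::real) *\<^sub>R E B u \<in> spectral_domain E f"
    "(0::real) *\<^sub>R u \<in> spectral_domain E f"
    by (intro spectral_domain_scale spectral_domain_project f B u)+
  \<comment> \<open>The measure of \<open>0\<close> vanishes; it only completes the identity to four terms.\<close>
  have "emeasure (?m (u + E B u)) C + emeasure (?m 0) C
      = emeasure (?m (u - E B u)) C + emeasure (?m (2 *\<^sub>R E B u)) C" if "C \<in> sets borel" for C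
  proof -
    have "inner (E C (u + E B u)) (u + E B u) + inner (E C 0) 0
      = inner (E C (u - E B u)) (u - E B u) + inner (E C (2 *\<^sub>R E B u)) (2 *\<^sub>R E B u)"
      using pvm_polarization[OF that, of u "E B u"] that B
      by (simp add: pvm_scale pvm_inner_Int pvm_Int Int_ac)
    then show ?thesis
      unfolding emeasure_scalar_measure_add[OF that] by (rule arg_cong)
  qed
  then have "(\<integral>t. f t \<partial>?m (u + E B u)) + (\<integral>t. f t \<partial>?m 0)
      = (\<integral>t. f t \<partial>?m (u - E B u)) + (\<integral>t. f t \<partial>?m (2 *\<^sub>R E B u))"
    using f u v by (intro integral_four_measures[where N = borel] spectral_domain_integrable
        spectral_domain_add_diff) auto
  moreover have "inner w (E B u) = ((\<integral>t. f t \<partial>?m (u + E B u)) - (\<integral>t. f t \<partial>?m (u - E B u))) / 4"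
    using uw v(1) by (simp add: spectral_integral_def)
  ultimately show ?thesis
    using f B by (simp add: integral_scalar_measure_zero integral_scalar_measure_scale
        integral_scalar_measure_project)
qed

text \<open>
  The signed measures \<open>\<langle>E u, E C v\<rangle>\<close> and \<open>\<langle>E E C u, v\<rangle>\<close> coincide, so \<open>E C\<close> can be moved from
  the test vector to \<open>u\<close>. Projections therefore reduce the operator, which yields elements of
  its domain with spectrum in a prescribed set.
\<close>

lemma spectral_integral_commutes_project:
  assumes f: "f \<in> borel_measurable borel" and uw: "(u, w) \<in> spectral_integral E f"
    and C: "C \<in> sets borel"
  shows "(E C u, E C w) \<in> spectral_integral E f"
proof -
  let ?m = "scalar_measure E"
  have u: "u \<in> spectral_domain E f"
    using uw by (simp add: spectral_integral_def)
  have Cu: "E C u \<in> spectral_domain E f"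
    by (intro spectral_domain_project f C u)
  have "inner (E C w) v = ((\<integral>t. f t \<partial>?m (E C u + v)) - (\<integral>t. f t \<partial>?m (E C u - v))) / 4"
    if v: "v \<in> spectral_domain E f" for v
  proof -
    have Cv: "E C v \<in> spectral_domain E f"
      by (intro spectral_domain_project f C v)
    have "emeasure (?m (u + E C v)) B + emeasure (?m (E C u - v)) B
      = emeasure (?m (u - E C v)) B + emeasure (?m (E C u + v)) B" if B: "B \<in> sets borel" for B
    proof -
      have "inner (E B u) (E C v) = inner (E B (E C u)) v"
        using B C by (simp add: pvm_inner_Int pvm_Int)
      then have "inner (E B (u + E C v)) (u + E C v) + inner (E B (E C u - v)) (E C u - v)
        = inner (E B (u - E C v)) (u - E C v) + inner (E B (E C u + v)) (E C u + v)"
        using pvm_polarization[OF B, of u "E C v"] pvm_polarization[OF B, of "E C u" v]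
        by simp
      then show ?thesis
        unfolding emeasure_scalar_measure_add[OF B] by (rule arg_cong)
    qed
    then have "(\<integral>t. f t \<partial>?m (u + E C v)) + (\<integral>t. f t \<partial>?m (E C u - v))
        = (\<integral>t. f t \<partial>?m (u - E C v)) + (\<integral>t. f t \<partial>?m (E C u + v))"
      using f u v Cu Cv
      by (intro integral_four_measures[where N = borel] spectral_domain_integrable
          spectral_domain_add_diff) auto
    moreover have "inner (E C w) v
        = ((\<integral>t. f t \<partial>?m (u + E C v)) - (\<integral>t. f t \<partial>?m (u - E C v))) / 4"
      using uw Cv pvm_sym[OF C, of w v] by (simp add: spectral_integral_def)
    ultimately show ?thesis
      by simp
  qed
  then show ?thesis
    using Cu by (simp add: spectral_integral_def)
qed

text \<open>
  The isometry \<open>|(\<integral> f dE) u|\<^sup>2 = \<integral> f\<^sup>2 d\<langle>E u, u\<rangle>\<close>. Where \<open>f \<le> n\<close>, testing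
  \<open>w = (\<integral> f dE) u\<close> with its own projection \<open>E {f \<le> n} w\<close> integrates \<open>f\<close> against the measure
  \<open>\<langle>E u, w\<rangle>\<close>, which has density \<open>f\<close>; then \<open>n\<close> tends to infinity.
\<close>

lemma spectral_integral_norm:
  assumes f [measurable]: "f \<in> borel_measurable borel" and nonneg: "\<And>t. 0 \<le> f t"
    and uw: "(u, w) \<in> spectral_integral E f"
  shows "ennreal ((norm w)\<^sup>2) = (\<integral>\<^sup>+t. ennreal ((f t)\<^sup>2) \<partial>scalar_measure E u)"
proof -
  let ?m = "scalar_measure E" and ?D = "spectral_domain E f"
  define N where "N = density (?m u) (\<lambda>t. ennreal ((f t)\<^sup>2))"
  have u: "u \<in> ?D"
    using uw by (simp add: spectral_integral_def)
  have zero: "0 \<in> ?D"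
    using spectral_domain_scale[OF f u, of 0] by simp
  have level: "emeasure (?m w) {t. \<bar>f t\<bar> \<le> real n} = emeasure N {t. \<bar>f t\<bar> \<le> real n}" for n
  proof -
    define C where "C = {t. \<bar>f t\<bar> \<le> real n}"
    have C [measurable]: "C \<in> sets borel"
      unfolding C_def by measurable
    \<comment> \<open>By polarization, \<open>g\<close> is the density, relative to the measure of \<open>u\<close>, of the measure of
      \<open>u + v\<close> minus that of \<open>u - v\<close>.\<close>
    define g where "g = (\<lambda>t. 4 * (indicator C t * f t))"
    have g [measurable]: "g \<in> borel_measurable borel" and g0: "\<And>t. 0 \<le> g t"
      using nonneg by (auto simp: g_def)
    define v where "v = E C w"
    have v: "v \<in> ?D"
      unfolding v_def by (rule spectral_domain_project_bounded[OF f C]) (auto simp: C_def)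
    have int_f2: "integrable (?m u) (\<lambda>t. indicator C t * (f t)\<^sup>2)"
      using integrable_mult_indicator[of C "?m u" "\<lambda>t. (f t)\<^sup>2"] spectral_domain_integrable(2)[OF f u]
      by simp
    have gf: "(\<lambda>t. g t * f t) = (\<lambda>t. 4 * (indicator C t * (f t)\<^sup>2))"
      by (auto simp: g_def power2_eq_square)
    have "emeasure (?m (u + v)) B + emeasure (?m 0) B
      = emeasure (?m (u - v)) B + emeasure (density (?m u) (\<lambda>t. ennreal (g t))) B"
      if B [measurable]: "B \<in> sets borel" for B
    proof -
      have "inner (E B u) v = inner w (E (B \<inter> C) u)"
        using B C by (simp add: v_def pvm_inner_Int inner_commute)
      also have "\<dots> = (\<integral>t. indicator (B \<inter> C) t * f t \<partial>?m u)"
        using B C by (intro spectral_integral_inner_project[OF f uw]) auto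
      moreover have gB: "(\<lambda>t. g t * indicator B t) = (\<lambda>t. 4 * (indicator (B \<inter> C) t * f t))"
        by (auto simp: g_def indicator_def)
      ultimately have inner_uv: "4 * inner (E B u) v = (\<integral>t. g t * indicator B t \<partial>?m u)"
        by simp
      have "integrable (?m u) (\<lambda>t. indicator (B \<inter> C) t * f t)"
        using integrable_mult_indicator[of "B \<inter> C" "?m u" f] spectral_domain_integrable(1)[OF f u]
        by simp
      then have "integrable (?m u) (\<lambda>t. g t * indicator B t)"
        by (simp add: gB)
      then have "ennreal (4 * inner (E B u) v) = (\<integral>\<^sup>+t. ennreal (g t * indicator B t) \<partial>?m u)"
        using g0 by (simp add: inner_uv nn_integral_eq_integral)
      also have "\<dots> = emeasure (density (?m u) (\<lambda>t. ennreal (g t))) B"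
        by (simp add: emeasure_density)
          (auto intro!: nn_integral_cong simp: indicator_def)
      finally have dens: "emeasure (density (?m u) (\<lambda>t. ennreal (g t))) B
        = ennreal (4 * inner (E B u) v)" ..
      have "0 \<le> 4 * inner (E B u) v"
        unfolding inner_uv using g0 by (simp add: Bochner_Integration.integral_nonneg)
      then show ?thesis
        using pvm_polarization[OF B, of u v] pvm_form_nonneg[OF B, of "u - v"]
        by (simp add: dens emeasure_scalar_measure pvm_form_nonneg algebra_simps flip: ennreal_plus)
    qed
    then have "(\<integral>t. f t \<partial>?m (u + v)) + (\<integral>t. f t \<partial>?m 0)
      = (\<integral>t. f t \<partial>?m (u - v)) + (\<integral>t. f t \<partial>density (?m u) (\<lambda>t. ennreal (g t)))"
      using f u v zero g0 int_f2
      by (intro integral_four_measures[where N = borel] spectral_domain_integrable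
          spectral_domain_add_diff) (auto simp: integrable_density gf)
    moreover have "(\<integral>t. f t \<partial>density (?m u) (\<lambda>t. ennreal (g t)))
        = 4 * (\<integral>t. indicator C t * (f t)\<^sup>2 \<partial>?m u)"
      using g0 by (simp add: integral_density gf)
    moreover have "inner w v = ((\<integral>t. f t \<partial>?m (u + v)) - (\<integral>t. f t \<partial>?m (u - v))) / 4"
      using uw v by (simp add: spectral_integral_def)
    ultimately have "inner w v = (\<integral>t. indicator C t * (f t)\<^sup>2 \<partial>?m u)"
      by (simp add: integral_scalar_measure_zero)
    then have "emeasure (?m w) C = (\<integral>\<^sup>+t. ennreal (indicator C t * (f t)\<^sup>2) \<partial>?m u)"
      using int_f2 C by (simp add: nn_integral_eq_integral emeasure_scalar_measure v_def inner_commute)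
    also have "\<dots> = emeasure N C"
      by (simp add: N_def emeasure_density)
        (auto intro!: nn_integral_cong simp: indicator_def)
    finally show ?thesis
      by (simp add: C_def)
  qed
  have "(\<lambda>n. emeasure M {t. \<bar>f t\<bar> \<le> real n}) \<longlonglongrightarrow> emeasure M UNIV"
    if "sets M = sets borel" for M
    using Lim_emeasure_incseq[of "\<lambda>n. {t. \<bar>f t\<bar> \<le> real n}" M] level_set_exhaustion[OF f] that
    by simp
  from LIMSEQ_unique[OF this[of "?m w"]] this[of N] have "emeasure (?m w) UNIV = emeasure N UNIV"
    by (simp add: level N_def)
  then show ?thesis
    by (simp add: emeasure_scalar_measure pvm_UNIV N_def emeasure_density power2_norm_eq_inner)
qed

end

section \<open>The square root of a coercive self-adjoint operator\<close>

lemma op_app_eq: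
  assumes "\<And>x y y'. (x, y) \<in> G \<Longrightarrow> (x, y') \<in> G \<Longrightarrow> y = y'" and "(u, w) \<in> G"
  shows "op_app G u = w"
  unfolding op_app_def using assms by blast

lemma linear_op_app:
  assumes "linear_op A" "(u, w) \<in> A"
  shows "op_app A u = w"
  using assms by (intro op_app_eq) (auto simp: linear_op_def dest: single_valuedD)

lemma linear_op_graph:
  assumes "linear_op A" "u \<in> Domain A"
  shows "(u, op_app A u) \<in> A"
  using assms linear_op_app by fastforce

lemma linear_op_app_diff:
  assumes A: "linear_op A" and "u \<in> Domain A" "v \<in> Domain A"
  shows "op_app A (u - v) = op_app A u - op_app A v"
proof -
  have "(u, op_app A u) - (v, op_app A v) \<in> A"
    using assms by (intro subspace_diff linear_op_graph) (auto simp: linear_op_def)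
  then show ?thesis
    using linear_op_app[OF A] by simp
qed

lemma self_adjoint_symmetric:
  assumes "self_adjoint A" and "u \<in> Domain A" "v \<in> Domain A"
  shows "inner (op_app A u) v = inner u (op_app A v)"
proof -
  have A: "linear_op A" "adjoint_op A = A"
    using assms by (auto simp: self_adjoint_def)
  have "(v, op_app A v) \<in> adjoint_op A" "(u, op_app A u) \<in> A"
    using A assms by (simp_all add: linear_op_graph)
  then show ?thesis
    unfolding adjoint_op_def by blast
qed

lemma coercive_form_pos:
  fixes A :: "'a::real_inner graph_op"
  assumes A: "linear_op A"
    and coercive: "0 < (INF x\<in>{x \<in> Domain A. norm x = 1}. ereal (inner (op_app A x) x))"
    and y: "(y, w) \<in> A" "y \<noteq> 0"
  shows "0 < inner w y"
proof -
  define r where "r = inverse (norm y)"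
  have r: "r > 0" "norm (r *\<^sub>R y) = 1"
    using y by (auto simp: r_def)
  have "r *\<^sub>R (y, w) \<in> A"
    using A y by (intro subspace_scale) (auto simp: linear_op_def)
  then have ry: "(r *\<^sub>R y, r *\<^sub>R w) \<in> A"
    by simp
  have "(INF x\<in>{x \<in> Domain A. norm x = 1}. ereal (inner (op_app A x) x))
      \<le> ereal (inner (op_app A (r *\<^sub>R y)) (r *\<^sub>R y))"
    using ry r by (intro INF_lower) auto
  from less_le_trans[OF coercive this] have "0 < inner (op_app A (r *\<^sub>R y)) (r *\<^sub>R y)"
    by simp
  then show ?thesis
    using r by (simp add: linear_op_app[OF A ry] zero_less_mult_iff)
qed

text \<open>
  A vector in the range of the projection onto \<open>(-\<infinity>, 0]\<close> makes the quadratic form of \<open>A\<close>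
  nonpositive. As this projection maps the domain of \<open>A\<close> into itself, positivity of the form
  leaves only the zero vector.
\<close>

lemma spectral_measure_nonpos_null:
  assumes pvm: "projection_valued_measure E"
    and pos: "\<And>y w. (y, w) \<in> spectral_integral E (\<lambda>x. x) \<Longrightarrow> y \<noteq> 0 \<Longrightarrow> 0 < inner w y"
    and ua: "(u, a) \<in> spectral_integral E (\<lambda>x. x)"
  shows "AE t in scalar_measure E u. 0 < t"
proof -
  let ?C = "{..0::real}"
  have C: "?C \<in> sets borel"
    by simp
  have "inner (E ?C a) (E ?C u) = inner a (E ?C u)"
    using pvm_inner_Int[OF pvm C C] pvm_sym[OF pvm C] by simp
  also have "\<dots> = (\<integral>t. indicator ?C t * t \<partial>scalar_measure E u)"
    by (rule spectral_integral_inner_project[OF pvm _ ua C]) simp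
  also have "\<dots> = - (\<integral>t. indicator ?C t * (- t) \<partial>scalar_measure E u)"
    by simp
  also have "\<dots> \<le> 0"
    by (simp only: neg_le_0_iff_le) (rule Bochner_Integration.integral_nonneg, auto simp: indicator_def)
  finally have "E ?C u = 0"
    using pos[OF spectral_integral_commutes_project[OF pvm _ ua C]] by fastforce
  then have "emeasure (scalar_measure E u) ?C = 0"
    by (simp add: emeasure_scalar_measure[OF pvm])
  then show ?thesis
    by (intro AE_I[of _ _ ?C]) (auto simp: space_scalar_measure[OF pvm] sets_scalar_measure[OF pvm])
qed

text \<open>
  The energy identity \<open>|A\<^bsup>1/2\<^esup> x|\<^sup>2 = \<langle>A x, x\<rangle>\<close>: both sides are the integral of the identity
  function against the scalar measure of \<open>x\<close>. On the left this identity function is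
  \<open>(t powr (1/2))\<^sup>2\<close>, which equals \<open>t\<close> because the measure charges positive \<open>t\<close> only.
\<close>

lemma op_powr_half_norm:
  fixes A :: "'a::real_inner graph_op"
  assumes A: "linear_op A"
    and coercive: "0 < (INF x\<in>{x \<in> Domain A. norm x = 1}. ereal (inner (op_app A x) x))"
    and x: "x \<in> Domain A" "x \<in> Domain (op_powr A (1/2))"
  shows "(norm (op_app (op_powr A (1/2)) x))\<^sup>2 = inner (op_app A x) x"
proof -
  define E where "E = (SOME E. spectral_resolution A E)"
  \<comment> \<open>Without a spectral resolution the power would be the empty graph, so the hypothesis on
    its domain supplies one.\<close>
  have ex: "\<exists>E. spectral_resolution A E"
    using x(2) by (auto simp: op_powr_def split: if_splits)
  then have "spectral_resolution A E"
    unfolding E_def by (rule someI_ex)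
  then have pvm: "projection_valued_measure E" and AE: "A = spectral_integral E (\<lambda>x. x)"
    by (auto simp: spectral_resolution_def)
  let ?f = "\<lambda>t::real. t powr (1/2)" and ?m = "scalar_measure E x"
  have root: "op_powr A (1/2) = spectral_integral E ?f"
    using ex by (simp add: op_powr_def E_def)
  have f: "?f \<in> borel_measurable borel"
    by measurable
  obtain w where w: "(x, w) \<in> spectral_integral E ?f"
    using x(2) root by auto
  have app_root: "op_app (op_powr A (1/2)) x = w"
    unfolding root using spectral_integral_single_valued[OF pvm f] w by (rule op_app_eq)
  have xa: "(x, op_app A x) \<in> spectral_integral E (\<lambda>x. x)"
    using linear_op_graph[OF A x(1)] AE by simp
  have pos: "AE t in ?m. 0 < t"
    by (rule spectral_measure_nonpos_null[OF pvm _ xa])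
      (use coercive_form_pos[OF A coercive] AE in auto)
  have "x \<in> spectral_domain E (\<lambda>x. x)"
    using xa by (simp add: spectral_integral_def)
  then have int: "integrable ?m (\<lambda>t. t)"
    by (intro spectral_domain_integrable[OF pvm]) auto
  have "inner (op_app A x) x = (\<integral>t. t \<partial>?m)"
    using spectral_integral_inner_project[OF pvm _ xa, of UNIV] by (simp add: pvm_UNIV[OF pvm])
  moreover have "ennreal ((norm w)\<^sup>2) = (\<integral>\<^sup>+t. ennreal ((?f t)\<^sup>2) \<partial>?m)"
    by (rule spectral_integral_norm[OF pvm f _ w]) simp
  moreover have "\<dots> = (\<integral>\<^sup>+t. ennreal t \<partial>?m)"
    using pos by (intro nn_integral_cong_AE) (auto elim!: eventually_mono simp: powr_half_sqrt)
  moreover have "\<dots> = ennreal (\<integral>t. t \<partial>?m)"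
    using int pos by (intro nn_integral_eq_integral) (auto elim!: eventually_mono)
  moreover have "0 \<le> (\<integral>t. t \<partial>?m)"
    using pos by (intro integral_nonneg_AE) (auto elim!: eventually_mono)
  ultimately show ?thesis
    by (simp add: app_root)
qed

section \<open>Differentiating the quadratic form\<close>

lemma has_vector_derivative_quotient:
  fixes f :: "real \<Rightarrow> 'a::real_normed_vector"
  assumes "(f has_vector_derivative D) (at x within S)"
  shows "((\<lambda>y. (f y - f x) /\<^sub>R (y - x)) \<longlongrightarrow> D) (at x within S)"
proof (rule LIM_zero_cancel)
  have lim: "((\<lambda>y. norm ((1 / norm (y - x)) *\<^sub>R (f y - (f x + (y - x) *\<^sub>R D)))) \<longlongrightarrow> 0)
      (at x within S)"
    using assms unfolding has_vector_derivative_def has_derivative_within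
    by (intro tendsto_norm_zero) simp
  have "norm ((1 / norm (y - x)) *\<^sub>R (f y - (f x + (y - x) *\<^sub>R D)))
      = norm ((f y - f x) /\<^sub>R (y - x) - D)" if "y \<noteq> x" for y
  proof -
    have "(f y - f x) /\<^sub>R (y - x) - D = (1 / (y - x)) *\<^sub>R (f y - (f x + (y - x) *\<^sub>R D))"
      using that by (simp add: scaleR_diff_right scaleR_add_right inverse_eq_divide)
    then show ?thesis
      by (simp only: norm_scaleR) simp
  qed
  then have "((\<lambda>y. norm ((f y - f x) /\<^sub>R (y - x) - D)) \<longlongrightarrow> 0) (at x within S)"
    by (intro Lim_transform_within[OF lim, of 1]) auto
  then show "((\<lambda>y. (f y - f x) /\<^sub>R (y - x) - D) \<longlongrightarrow> 0) (at x within S)"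
    by (rule tendsto_norm_zero_cancel)
qed

lemma C0_domain_tendsto:
  assumes A: "linear_op A" and u: "C0_domain A u" and t: "t \<ge> 0"
  shows "((\<lambda>s. op_app A (u s)) \<longlongrightarrow> op_app A (u t)) (at t within {0..})"
proof -
  have dom: "u s \<in> Domain A" if "s \<ge> 0" for s
    using u that by (auto simp: C0_domain_def)
  have lim: "((\<lambda>s. graph_norm A (u s - u t)) \<longlongrightarrow> 0) (at t within {0..})"
    using u t by (auto simp: C0_domain_def)
  have "\<forall>\<^sub>F s in at t within {0..}. norm (op_app A (u s) - op_app A (u t)) \<le> graph_norm A (u s - u t)"
    unfolding eventually_at_filter
  proof (intro always_eventually allI impI)
    fix s :: real
    assume "s \<in> {0..}"
    then show "norm (op_app A (u s) - op_app A (u t)) \<le> graph_norm A (u s - u t)"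
      using dom t by (simp add: graph_norm_def linear_op_app_diff[OF A] real_le_rsqrt)
  qed
  then show ?thesis
    by (rule LIM_zero_cancel[OF Lim_null_comparison[OF _ lim]])
qed

text \<open>
  Symmetry of \<open>A\<close> gives
  \<open>\<langle>A u(s), u(s)\<rangle> - \<langle>A u(t), u(t)\<rangle> = \<langle>A u(s) + A u(t), u(s) - u(t)\<rangle>\<close>, so the
  difference quotient converges by the differentiability of \<open>u\<close> and the continuity of \<open>A u\<close>.
\<close>

lemma quadratic_form_derivative:
  fixes u :: "real \<Rightarrow> 'a::real_inner"
  assumes A: "self_adjoint A" and u: "C0_domain A u" and t: "t \<ge> 0"
    and deriv: "(u has_vector_derivative D) (at t within {0..})"
  shows "((\<lambda>s. inner (op_app A (u s)) (u s)) has_real_derivative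
    2 * inner (op_app A (u t)) (D)) (at t within {0..})"
proof -
  have lin: "linear_op A"
    using A by (simp add: self_adjoint_def)
  have dom: "u s \<in> Domain A" if "s \<ge> 0" for s
    using u that by (auto simp: C0_domain_def)
  have "((\<lambda>s. (u s - u t) /\<^sub>R (s - t)) \<longlongrightarrow> D) (at t within {0..})"
    by (rule has_vector_derivative_quotient[OF deriv])
  then have lim: "((\<lambda>s. inner (op_app A (u s) + op_app A (u t)) ((u s - u t) /\<^sub>R (s - t)))
      \<longlongrightarrow> inner (op_app A (u t) + op_app A (u t)) (D)) (at t within {0..})"
    by (intro tendsto_intros C0_domain_tendsto[OF lin u t])
  have quotient: "inner (op_app A (u s) + op_app A (u t)) ((u s - u t) /\<^sub>R (s - t))
      = (inner (op_app A (u s)) (u s) - inner (op_app A (u t)) (u t)) / (s - t)" if "s \<ge> 0" for s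
    using self_adjoint_symmetric[OF A dom[OF that] dom[OF t]]
    by (simp add: inner_simps inner_commute divide_inverse algebra_simps)
  have "((\<lambda>s. (inner (op_app A (u s)) (u s) - inner (op_app A (u t)) (u t)) / (s - t))
      \<longlongrightarrow> inner (op_app A (u t) + op_app A (u t)) (D)) (at t within {0..})"
    by (rule Lim_transform_within[OF lim, of 1]) (use quotient in auto)
  then show ?thesis
    by (simp add: has_field_derivative_iff inner_add_left)
qed

section \<open>Differential inequalities on the half-line\<close>

lemma nondecreasing_half_line:
  fixes f f' :: "real \<Rightarrow> real"
  assumes deriv: "\<And>t. t \<ge> 0 \<Longrightarrow> (f has_real_derivative f' t) (at t within {0..})"
    and a: "0 \<le> a" "a \<le> b" and nonneg: "\<And>t. a \<le> t \<Longrightarrow> 0 \<le> f' t"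
  shows "f a \<le> f b"
proof (rule DERIV_nonneg_imp_increasing_open[OF a(2)])
  show "\<exists>y. (f has_real_derivative y) (at x) \<and> 0 \<le> y" if "a < x" "x < b" for x
  proof -
    have "at x within {0..} = at x"
      using that a by (intro at_within_interior) auto
    then show ?thesis
      using deriv[of x] nonneg[of x] that a by auto
  qed
  have "continuous_on {0..} f"
    using deriv by (intro DERIV_continuous_on) auto
  then show "continuous_on {a..b} f"
    by (rule continuous_on_subset) (use a in auto)
qed

text \<open>
  \<open>e(t) exp(k t)\<close> is nondecreasing, hence never falls below its positive initial value.
\<close>

lemma exponential_lower_bound_pos:
  fixes e e' :: "real \<Rightarrow> real"
  assumes deriv: "\<And>t. t \<ge> 0 \<Longrightarrow> (e has_real_derivative e' t) (at t within {0..})"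
    and e0: "0 < e 0" and ineq: "\<And>t. t \<ge> 0 \<Longrightarrow> - (k * e t) \<le> e' t" and t: "t \<ge> 0"
  shows "0 < e t"
proof -
  have "((\<lambda>t. e t * exp (k * t)) has_real_derivative (e' t + k * e t) * exp (k * t))
      (at t within {0..})" if "t \<ge> 0" for t
    by (rule derivative_eq_intros deriv[OF that] refl)+ (simp add: algebra_simps)
  then have "e 0 * exp (k * 0) \<le> e t * exp (k * t)"
  proof (rule nondecreasing_half_line)
    show "0 \<le> (e' s + k * e s) * exp (k * s)" if "0 \<le> s" for s
      using ineq[OF that] by simp
  qed (use t in simp_all)
  with e0 have "0 < e t * exp (k * t)"
    by simp
  then show ?thesis
    by (simp add: zero_less_mult_iff)
qed

text \<open>
  If a positive \<open>e\<close> decays at rate at most \<open>k (1 + t)\<^bsup>-p\<^esup>\<close> and \<open>\<Phi>\<close> eventually decays at a rate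
  of at least \<open>(k + 1) (1 + t)\<^bsup>-p\<^esup>\<close>, the logarithmic derivative of \<open>e / \<Phi>\<close> is eventually at
  least \<open>(1 + t)\<^bsup>-p\<^esup> \<ge> 1 / (1 + t)\<close>, as \<open>p \<le> 1\<close>. Then \<open>e / \<Phi>\<close> grows at least linearly, which
  is seen from the monotonicity of \<open>e / (\<Phi> (1 + t))\<close>.
\<close>

lemma ratio_at_top:
  fixes e e' \<Phi> \<Phi>' :: "real \<Rightarrow> real"
  assumes p: "p \<le> 1"
    and e: "\<And>t. t \<ge> 0 \<Longrightarrow> (e has_real_derivative e' t) (at t within {0..})"
    and e_pos: "\<And>t. t \<ge> 0 \<Longrightarrow> 0 < e t"
    and ineq: "\<And>t. t \<ge> 0 \<Longrightarrow> - (k / (1 + t) powr p * e t) \<le> e' t"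
    and \<Phi>_pos: "\<And>t. t \<ge> 0 \<Longrightarrow> 0 < \<Phi> t"
    and \<Phi>: "\<And>t. t \<ge> 0 \<Longrightarrow> (\<Phi> has_real_derivative \<Phi>' t) (at t within {0..})"
    and decay: "filterlim (\<lambda>t. (1 + t) powr p * (\<Phi>' t / \<Phi> t)) at_bot at_top"
  shows "filterlim (\<lambda>t. e t / \<Phi> t) at_top at_top"
proof -
  have "\<forall>\<^sub>F t in at_top. (1 + t) powr p * (\<Phi>' t / \<Phi> t) \<le> - (k + 1)"
    using decay by (simp add: filterlim_at_bot)
  then obtain T0 where T0: "\<And>t. t \<ge> T0 \<Longrightarrow> (1 + t) powr p * (\<Phi>' t / \<Phi> t) \<le> - (k + 1)"
    by (auto simp: eventually_at_top_linorder)
  define T where "T = max 0 T0"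
  define f where "f = (\<lambda>t. e t / (\<Phi> t * (1 + t)))"
  define f' where "f' = (\<lambda>t. f t * (e' t / e t - \<Phi>' t / \<Phi> t - 1 / (1 + t)))"
  have f: "(f has_real_derivative f' t) (at t within {0..})" if t: "t \<ge> 0" for t
  proof -
    have ne: "e t \<noteq> 0" "\<Phi> t \<noteq> 0" "1 + t \<noteq> 0"
      using e_pos[OF t] \<Phi>_pos[OF t] t by auto
    have "(f has_real_derivative
        (e' t * (\<Phi> t * (1 + t)) - e t * (\<Phi>' t * (1 + t) + 1 * \<Phi> t))
          / (\<Phi> t * (1 + t) * (\<Phi> t * (1 + t)))) (at t within {0..})"
      unfolding f_def using ne
      by (intro DERIV_divide DERIV_mult e[OF t] \<Phi>[OF t]) (auto intro!: derivative_eq_intros)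
    moreover have "f' t = (e' t * (\<Phi> t * (1 + t)) - e t * (\<Phi>' t * (1 + t) + 1 * \<Phi> t))
          / (\<Phi> t * (1 + t) * (\<Phi> t * (1 + t)))"
      using ne by (simp add: f'_def f_def divide_simps) (simp add: algebra_simps)
    ultimately show ?thesis
      by simp
  qed
  have f_pos: "0 < f t" if "t \<ge> 0" for t
    using e_pos[OF that] \<Phi>_pos[OF that] that by (simp add: f_def)
  have f'_nonneg: "0 \<le> f' t" if "T \<le> t" for t
  proof -
    have t: "t \<ge> 0" "t \<ge> T0"
      using that by (auto simp: T_def)
    define q where "q = (1 + t) powr p"
    have q: "0 < q" "q \<le> 1 + t"
      using t p powr_mono[of p 1 "1 + t"] by (auto simp: q_def)
    have "\<Phi>' t / \<Phi> t \<le> - (k + 1) / q"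
      using T0[OF t(2)] q by (simp add: q_def pos_le_divide_eq mult.commute)
    moreover have "- (k / q) \<le> e' t / e t"
      using ineq[OF t(1)] e_pos[OF t(1)] by (simp add: q_def pos_le_divide_eq)
    moreover have "1 / (1 + t) \<le> 1 / q"
      using q t by (intro divide_left_mono) auto
    ultimately have "0 \<le> e' t / e t - \<Phi>' t / \<Phi> t - 1 / (1 + t)"
      by (simp add: add_divide_distrib diff_divide_distrib)
    then show ?thesis
      using f_pos[OF t(1)] by (simp add: f'_def)
  qed
  have "\<forall>\<^sub>F t in at_top. f T * (1 + t) \<le> e t / \<Phi> t"
    using eventually_ge_at_top[of T]
  proof eventually_elim
    case (elim t)
    have "f T \<le> f t"
      by (rule nondecreasing_half_line[OF f _ elim f'_nonneg]) (auto simp: T_def)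
    moreover have "0 < 1 + t"
      using elim by (auto simp: T_def)
    ultimately show ?case
      by (simp add: f_def pos_le_divide_eq flip: divide_divide_eq_left)
  qed
  moreover have "filterlim (\<lambda>t. f T * (1 + t)) at_top at_top"
  proof (rule filterlim_tendsto_pos_mult_at_top[OF tendsto_const])
    show "0 < f T"
      by (rule f_pos) (simp add: T_def)
    show "filterlim (\<lambda>t::real. 1 + t) at_top at_top"
      by (rule filterlim_tendsto_add_at_top[OF tendsto_const filterlim_ident])
  qed
  ultimately show ?thesis
    by (rule filterlim_at_top_mono[rotated])
qed

section \<open>The lower bound for the energy\<close>

theorem theorem2p11:
  fixes A :: "'a::{real_inner, complete_space} graph_op"
    and p \<epsilon> \<mu> M3 M4 :: real
    and u0 u1 :: 'a
    and c c' :: "real \<Rightarrow> real"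
    and u u' u'' :: "real \<Rightarrow> 'a"
  assumes A_self_adjoint: "self_adjoint A"
    and A_coercive: "0 < (INF x\<in>{x \<in> Domain A. norm x = 1}. ereal (inner (op_app A x) x))"
    and p: "0 \<le> p" "p \<le> 1"
    and data: "u0 \<in> Domain A" "u1 \<in> Domain (op_powr A (1/2))"
    and eps: "\<epsilon> > 0"
    and c_pos: "\<And>t. t \<ge> 0 \<Longrightarrow> c t > 0"
    and c_deriv: "\<And>t. t \<ge> 0 \<Longrightarrow> (c has_real_derivative c' t) (at t within {0..})"
    and c'_cont: "continuous_on {0..} c'"
    and mu: "\<mu> > 0"
    and c_bounds: "\<And>t. t \<ge> 0 \<Longrightarrow> \<mu> \<le> c t \<and> c t \<le> M3"
    and c'_bound: "\<And>t. t \<ge> 0 \<Longrightarrow> \<bar>c' t\<bar> \<le> M4 / (1 + t) powr p"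
    and u_deriv: "\<And>t. t \<ge> 0 \<Longrightarrow> (u has_vector_derivative u' t) (at t within {0..})"
    and u'_deriv: "\<And>t. t \<ge> 0 \<Longrightarrow> (u' has_vector_derivative u'' t) (at t within {0..})"
    and u''_cont: "continuous_on {0..} u''"
    and u_C1: "C1_domain (op_powr A (1/2)) u u'"
    and u_C0: "C0_domain A u"
    and equation: "\<And>t. t \<ge> 0 \<Longrightarrow>
      \<epsilon> *\<^sub>R u'' t + (1 / (1 + t) powr p) *\<^sub>R u' t + c t *\<^sub>R op_app A (u t) = 0"
    and initial: "u 0 = u0" "u' 0 = u1"
    and nontrivial: "(u0, u1) \<noteq> (0, 0)"
  shows "\<forall>\<Phi> \<Phi>' :: real \<Rightarrow> real.
    (\<forall>t\<ge>0. \<Phi> t > 0) \<longrightarrow>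
    (\<forall>t\<ge>0. (\<Phi> has_real_derivative \<Phi>' t) (at t within {0..})) \<longrightarrow>
    continuous_on {0..} \<Phi>' \<longrightarrow>
    filterlim (\<lambda>t. (1 + t) powr p * (\<Phi>' t / \<Phi> t)) at_bot at_top \<longrightarrow>
    filterlim (\<lambda>t. (\<epsilon> * (norm (u' t))\<^sup>2 + (norm (op_app (op_powr A (1/2)) (u t)))\<^sup>2) * (1 / \<Phi> t))
      at_top at_top"
proof (intro allI impI)
  fix \<Phi> \<Phi>' :: "real \<Rightarrow> real"
  assume \<Phi>_pos: "\<forall>t\<ge>0. \<Phi> t > 0"
    and \<Phi>_deriv: "\<forall>t\<ge>0. (\<Phi> has_real_derivative \<Phi>' t) (at t within {0..})"
    and decay: "filterlim (\<lambda>t. (1 + t) powr p * (\<Phi>' t / \<Phi> t)) at_bot at_top"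
  have lin: "linear_op A"
    using A_self_adjoint by (simp add: self_adjoint_def)
  have dom: "u t \<in> Domain A" "u t \<in> Domain (op_powr A (1/2))" if "t \<ge> 0" for t
    using u_C0 u_C1 that by (auto simp: C0_domain_def C1_domain_def)
  define F where "F = (\<lambda>t. inner (op_app A (u t)) (u t))"
  have root: "(norm (op_app (op_powr A (1/2)) (u t)))\<^sup>2 = F t" if "t \<ge> 0" for t
    using op_powr_half_norm[OF lin A_coercive dom[OF that]] by (simp add: F_def)
  have F_nonneg: "0 \<le> F t" if "t \<ge> 0" for t
    using root[OF that] by (metis zero_le_power2)
  \<comment> \<open>Weighting the elastic part by \<open>c\<close> makes the terms with \<open>\<langle>A u, u'\<rangle>\<close> cancel in the
    derivative, which leaves the damping and the term with \<open>c'\<close>.\<close>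
  define e where "e = (\<lambda>t. \<epsilon> * inner (u' t) (u' t) + c t * F t)"
  define e' where "e' = (\<lambda>t. c' t * F t - 2 / (1 + t) powr p * inner (u' t) (u' t))"
  have e_deriv: "(e has_real_derivative e' t) (at t within {0..})" if t: "t \<ge> 0" for t
  proof -
    have "((\<lambda>t. inner (u' t) (u' t)) has_real_derivative inner (u' t) (u'' t) + inner (u'' t) (u' t))
        (at t within {0..})"
      using bounded_bilinear.has_vector_derivative[OF bounded_bilinear_inner u'_deriv[OF t] u'_deriv[OF t]]
      by (simp add: has_real_derivative_iff_has_vector_derivative)
    moreover have "(F has_real_derivative 2 * inner (op_app A (u t)) (u' t)) (at t within {0..})"
      unfolding F_def by (rule quadratic_form_derivative[OF A_self_adjoint u_C0 t u_deriv[OF t]])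
    ultimately have "(e has_real_derivative
        \<epsilon> * (inner (u' t) (u'' t) + inner (u'' t) (u' t))
        + (c' t * F t + 2 * inner (op_app A (u t)) (u' t) * c t)) (at t within {0..})"
      unfolding e_def by (intro DERIV_add DERIV_cmult DERIV_mult c_deriv[OF t])
    moreover have "\<epsilon> * inner (u'' t) (u' t) + 1 / (1 + t) powr p * inner (u' t) (u' t)
        + c t * inner (op_app A (u t)) (u' t) = 0"
      using arg_cong[OF equation[OF t], of "\<lambda>x. inner x (u' t)"] by (simp add: inner_add_left)
    ultimately show ?thesis
      by (simp add: e'_def inner_commute algebra_simps)
        (erule back_subst[of "\<lambda>d. (e has_real_derivative d) (at t within {0..})"], simp)
  qed
  have M4: "0 \<le> M4"
    using c'_bound[of 0] by simp
  \<comment> \<open>The damping costs at most the rate \<open>2 / \<epsilon>\<close> relative to \<open>\<epsilon> |u'|\<^sup>2\<close>, and the variation of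
    \<open>c\<close> at most \<open>M4 / \<mu>\<close> relative to \<open>c \<langle>A u, u\<rangle>\<close>.\<close>
  define k where "k = 2 / \<epsilon> + M4 / \<mu>"
  have k: "0 \<le> k"
    using eps mu M4 by (simp add: k_def)
  have e_nonneg: "0 \<le> e t" if "t \<ge> 0" for t
    using F_nonneg[OF that] c_pos[OF that] eps by (simp add: e_def)
  have ineq: "- (k / (1 + t) powr p * e t) \<le> e' t" if t: "t \<ge> 0" for t
  proof -
    define q where "q = (1 + t) powr p"
    have q: "0 < q"
      using t by (simp add: q_def)
    have cF: "0 \<le> c t * F t" and uu: "0 \<le> \<epsilon> * inner (u' t) (u' t)"
      using F_nonneg[OF t] c_pos[OF t] eps by auto
    have "- (c' t * F t) \<le> M4 / q * F t"
      using c'_bound[OF t] F_nonneg[OF t] mult_right_mono[of "- c' t" "M4 / q" "F t"]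
      by (auto simp: q_def)
    also have "\<dots> = M4 / \<mu> / q * (\<mu> * F t)"
      using mu by simp
    also have "\<dots> \<le> M4 / \<mu> / q * (c t * F t)"
      using c_bounds[OF t] F_nonneg[OF t] M4 mu q by (intro mult_left_mono mult_right_mono) auto
    also have "\<dots> \<le> k / q * (c t * F t)"
      using cF q eps by (intro mult_right_mono divide_right_mono) (auto simp: k_def)
    finally have "- (c' t * F t) \<le> k / q * (c t * F t)" .
    moreover have "2 / q * inner (u' t) (u' t) = 2 / \<epsilon> / q * (\<epsilon> * inner (u' t) (u' t))"
      using eps by simp
    moreover have "\<dots> \<le> k / q * (\<epsilon> * inner (u' t) (u' t))"
      using uu q M4 mu by (intro mult_right_mono divide_right_mono) (auto simp: k_def)
    ultimately show ?thesis
      by (simp add: e_def e'_def distrib_left flip: q_def)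
  qed
  have e0: "0 < e 0"
  proof (cases "u0 = 0")
    case True
    then have "0 < inner (u' 0) (u' 0)"
      using nontrivial initial by simp
    then show ?thesis
      using F_nonneg[of 0] c_pos[of 0] eps by (simp add: e_def add_pos_nonneg)
  next
    case False
    then have "0 < F 0"
      using coercive_form_pos[OF lin A_coercive linear_op_graph[OF lin dom(1)[of 0]]] initial
      by (simp add: F_def)
    then show ?thesis
      using c_pos[of 0] eps by (simp add: e_def add_nonneg_pos)
  qed
  have e_pos: "0 < e t" if "t \<ge> 0" for t
  proof (rule exponential_lower_bound_pos[OF e_deriv e0 _ that])
    fix s :: real
    assume s: "s \<ge> 0"
    have "k / (1 + s) powr p \<le> k"
      using k s p by (simp add: divide_le_eq ge_one_powr_ge_zero mult_le_cancel_left1)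
    then have "k / (1 + s) powr p * e s \<le> k * e s"
      using e_nonneg[OF s] by (rule mult_right_mono)
    then show "- (k * e s) \<le> e' s"
      using ineq[OF s] by simp
  qed
  have lim: "filterlim (\<lambda>t. e t / \<Phi> t) at_top at_top"
    by (rule ratio_at_top[OF p(2) e_deriv e_pos ineq _ _ decay]) (use \<Phi>_pos \<Phi>_deriv in auto)
  \<comment> \<open>As \<open>c \<le> M3\<close>, the weight \<open>c\<close> can be dropped at the price of this factor.\<close>
  define m where "m = inverse (max 1 M3)"
  have m: "0 < m" "m \<le> 1" "m * M3 \<le> 1"
    by (auto simp: m_def inverse_eq_divide divide_le_eq_1 max_def)
  have "\<forall>\<^sub>F t in at_top. m * (e t / \<Phi> t)
      \<le> (\<epsilon> * (norm (u' t))\<^sup>2 + (norm (op_app (op_powr A (1/2)) (u t)))\<^sup>2) * (1 / \<Phi> t)"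
    using eventually_ge_at_top[of 0]
  proof eventually_elim
    case (elim t)
    have "m * c t \<le> 1"
      using mult_left_mono[of "c t" M3 m] c_bounds[OF elim] m by linarith
    then have "m * c t * F t \<le> 1 * F t"
      using F_nonneg[OF elim] by (rule mult_right_mono)
    moreover have "m * (\<epsilon> * inner (u' t) (u' t)) \<le> 1 * (\<epsilon> * inner (u' t) (u' t))"
      using m(2) eps by (intro mult_right_mono) auto
    ultimately have "m * e t \<le> \<epsilon> * (norm (u' t))\<^sup>2 + F t"
      by (simp add: e_def distrib_left mult.assoc power2_norm_eq_inner)
    then show ?case
      using divide_right_mono[of "m * e t" _ "\<Phi> t"] \<Phi>_pos elim
      by (simp add: root[OF elim] less_imp_le)
  qed
  moreover have "filterlim (\<lambda>t. m * (e t / \<Phi> t)) at_top at_top"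
    by (rule filterlim_tendsto_pos_mult_at_top[OF tendsto_const m(1) lim])
  ultimately show "filterlim (\<lambda>t. (\<epsilon> * (norm (u' t))\<^sup>2 + (norm (op_app (op_powr A (1/2)) (u t)))\<^sup>2)
      * (1 / \<Phi> t)) at_top at_top"
    by (rule filterlim_at_top_mono[rotated])
qed

end
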